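(* Let $k$ be a positive integer. There exists an integer $d_0$ (which may depend on $k$) such that for every integer $d\geq d_0$, $$\frac{1}{(kd)^{2d}}\leq\min\,\Phi(P)\leq\frac{1}{\bigl(k\sqrt{d}\bigr)^{\sqrt{d}}}$$ where the minimum is over all the lattice $(d,k)$-polytopes $P$ with at least two vertices and $\Phi(P)$ is the facial distance of $P$.
   Context: A polytope in $\mathbb{R}^d$ is the convex hull of a non-empty finite set of points. A lattice polytope is a polytope all of whose vertices belong to $\mathbb{Z}^d$. A lattice $(d,k)$-polytope is a lattice polytope (of any dimension) contained in the hypercube $[0,k]^d$. For polytopes $A,B\subset\mathbb{R}^d$, $d(A,B)$ denotes the minimal Euclidean distance between a point of $A$ and a point of $B$ (the letter $d$ alone denotes the dimension of the ambient space). The facial distance of a polytope $P$ with at least two vertices is $$\Phi(P)=\min\Bigl\{d\bigl(F,\mathrm{conv}(\mathcal{V}\setminus F)\bigr):F\in\mathcal{F}\Bigr\},$$ where $\mathcal{V}$ is the vertex set of $P$ and $\mathcal{F}$ is the set of the proper faces of $P$, that is, the non-empty faces of $P$ different from $P$ itself. *)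

theory Defs
  imports "HOL-Analysis.Analysis" "HOL-Library.Poly_Mapping"
begin

text \<open>
  The dimension of the ambient space is quantified inside the theorem, so it cannot be the
  cardinality of an index type. All the spaces \<open>\<real>\<^sup>d\<close> are therefore realised as subspaces of one
  real inner product space, the finitely supported sequences \<open>nat \<Rightarrow>\<^sub>0 real\<close> with the Euclidean
  inner product. The notions of convex hull, polytope, face, extreme point and distance between
  sets are then the library ones.
\<close>

instantiation poly_mapping :: (type, real_vector) real_vector
begin

lift_definition scaleR_poly_mapping :: "real \<Rightarrow> ('a \<Rightarrow>\<^sub>0 'b) \<Rightarrow> 'a \<Rightarrow>\<^sub>0 'b"
  is "\<lambda>r f k. r *\<^sub>R f k"
  by (erule rev_finite_subset) auto

instance
  by standard (transfer, simp add: fun_eq_iff algebra_simps)+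

end

lemma lookup_scaleR [simp]: "Poly_Mapping.lookup (r *\<^sub>R f) k = r *\<^sub>R Poly_Mapping.lookup f k"
  by transfer simp

instantiation poly_mapping :: (type, real_inner) real_inner
begin

definition inner_poly_mapping :: "('a \<Rightarrow>\<^sub>0 'b) \<Rightarrow> ('a \<Rightarrow>\<^sub>0 'b) \<Rightarrow> real"
  where "inner_poly_mapping f g =
    (\<Sum>k\<in>Poly_Mapping.keys f. Poly_Mapping.lookup f k \<bullet> Poly_Mapping.lookup g k)"

definition norm_poly_mapping :: "('a \<Rightarrow>\<^sub>0 'b) \<Rightarrow> real"
  where "norm_poly_mapping f = sqrt (f \<bullet> f)"

definition sgn_poly_mapping :: "('a \<Rightarrow>\<^sub>0 'b) \<Rightarrow> 'a \<Rightarrow>\<^sub>0 'b"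
  where "sgn_poly_mapping f = f /\<^sub>R norm f"

definition dist_poly_mapping :: "('a \<Rightarrow>\<^sub>0 'b) \<Rightarrow> ('a \<Rightarrow>\<^sub>0 'b) \<Rightarrow> real"
  where "dist_poly_mapping f g = norm (f - g)"

definition uniformity_poly_mapping :: "(('a \<Rightarrow>\<^sub>0 'b) \<times> ('a \<Rightarrow>\<^sub>0 'b)) filter"
  where "uniformity_poly_mapping = (INF e\<in>{0<..}. principal {(f, g). dist f g < e})"

definition open_poly_mapping :: "('a \<Rightarrow>\<^sub>0 'b) set \<Rightarrow> bool"
  where "open_poly_mapping U \<longleftrightarrow> (\<forall>f\<in>U. \<forall>\<^sub>F (f', g) in uniformity. f' = f \<longrightarrow> g \<in> U)"

lemma inner_poly_mapping_superset:
  fixes f g :: "'a \<Rightarrow>\<^sub>0 'b"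
  assumes "finite A" "Poly_Mapping.keys f \<subseteq> A"
  shows "f \<bullet> g = (\<Sum>k\<in>A. Poly_Mapping.lookup f k \<bullet> Poly_Mapping.lookup g k)"
  unfolding inner_poly_mapping_def using assms
  by (intro sum.mono_neutral_left) (auto simp: not_in_keys_iff_lookup_eq_zero)

instance
proof
  fix f g h :: "'a \<Rightarrow>\<^sub>0 'b" and r :: real
  show "dist f g = norm (f - g)"
    by (rule dist_poly_mapping_def)
  show "sgn f = f /\<^sub>R norm f"
    by (rule sgn_poly_mapping_def)
  show "uniformity = (INF e\<in>{0<..}. principal {(f, g :: 'a \<Rightarrow>\<^sub>0 'b). dist f g < e})"
    by (rule uniformity_poly_mapping_def)
  show "open U \<longleftrightarrow> (\<forall>f\<in>U. \<forall>\<^sub>F (f', g) in uniformity. f' = f \<longrightarrow> g \<in> U)"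
    for U :: "('a \<Rightarrow>\<^sub>0 'b) set"
    by (rule open_poly_mapping_def)
  show "norm f = sqrt (f \<bullet> f)"
    by (rule norm_poly_mapping_def)
  let ?A = "Poly_Mapping.keys f \<union> Poly_Mapping.keys g \<union> Poly_Mapping.keys h"
  have fin: "finite ?A" by simp
  have sub: "Poly_Mapping.keys f \<subseteq> ?A" "Poly_Mapping.keys g \<subseteq> ?A"
    "Poly_Mapping.keys (f + g) \<subseteq> ?A" "Poly_Mapping.keys (r *\<^sub>R f) \<subseteq> ?A"
    by (auto simp: in_keys_iff lookup_add simp del: lookup_not_eq_zero_eq_in_keys)
  note sup = inner_poly_mapping_superset[OF fin]
  show "f \<bullet> g = g \<bullet> f"
    unfolding sup[OF sub(1)] sup[OF sub(2)] by (intro sum.cong refl inner_commute)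
  show "(f + g) \<bullet> h = f \<bullet> h + g \<bullet> h"
    unfolding sup[OF sub(1)] sup[OF sub(2)] sup[OF sub(3)]
    by (simp only: lookup_add inner_add_left sum.distrib)
  show "r *\<^sub>R f \<bullet> g = r * (f \<bullet> g)"
    unfolding sup[OF sub(1)] sup[OF sub(4)]
    by (simp only: lookup_scaleR inner_scaleR_left sum_distrib_left)
  show "0 \<le> f \<bullet> f"
    by (simp add: inner_poly_mapping_def sum_nonneg)
  show "f \<bullet> f = 0 \<longleftrightarrow> f = 0"
    unfolding inner_poly_mapping_def
    by (subst sum_nonneg_eq_0_iff) (auto intro!: poly_mapping_eqI simp: not_in_keys_iff_lookup_eq_zero)
qed

end

definition euclidean_subspace :: "nat \<Rightarrow> (nat \<Rightarrow>\<^sub>0 real) set"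
  where "euclidean_subspace d = {x. Poly_Mapping.keys x \<subseteq> {..<d}}"

lemma dist_euclidean_subspace:
  assumes "x \<in> euclidean_subspace d" "y \<in> euclidean_subspace d"
  shows "dist x y = sqrt (\<Sum>i<d. (Poly_Mapping.lookup x i - Poly_Mapping.lookup y i)\<^sup>2)"
proof -
  have "Poly_Mapping.keys (x - y) \<subseteq> {..<d}"
    using assms keys_diff[of x y] unfolding euclidean_subspace_def by blast
  from inner_poly_mapping_superset[OF finite_lessThan this, of "x - y"] show ?thesis
    by (simp add: dist_poly_mapping_def norm_poly_mapping_def lookup_minus power2_eq_square)
qed

definition integer_lattice :: "nat \<Rightarrow> (nat \<Rightarrow>\<^sub>0 real) set"
  where "integer_lattice d = {x \<in> euclidean_subspace d. \<forall>i<d. Poly_Mapping.lookup x i \<in> \<int>}"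

definition hypercube :: "nat \<Rightarrow> nat \<Rightarrow> (nat \<Rightarrow>\<^sub>0 real) set"
  where "hypercube d k = {x \<in> euclidean_subspace d.
    \<forall>i<d. 0 \<le> Poly_Mapping.lookup x i \<and> Poly_Mapping.lookup x i \<le> real k}"

definition vertices :: "'a::real_vector set \<Rightarrow> 'a set"
  where "vertices P = {v. v extreme_point_of P}"

text \<open>The library predicate \<open>polytope\<close> also holds of the empty set, which is excluded here.\<close>

definition lattice_polytope :: "nat \<Rightarrow> nat \<Rightarrow> (nat \<Rightarrow>\<^sub>0 real) set \<Rightarrow> bool"
  where "lattice_polytope d k P \<longleftrightarrow>
    polytope P \<and> P \<noteq> {} \<and> vertices P \<subseteq> integer_lattice d \<and> P \<subseteq> hypercube d k"

definition proper_faces :: "'a::real_vector set \<Rightarrow> 'a set set"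
  where "proper_faces P = {F. F face_of P \<and> F \<noteq> {} \<and> F \<noteq> P}"

definition facial_distance :: "'a::real_inner set \<Rightarrow> real"
  where "facial_distance P =
    Min ((\<lambda>F. setdist F (convex hull (vertices P - F))) ` proper_faces P)"

end

(*
Lower bound. A face F of P and Q = conv (V - F) are disjoint, so their distance is the norm of the
shortest vector r in the convex hull of the differences w = p - q of their vertices. All w that
contribute to r satisfy w . r = |r|^2; if b_1, ..., b_n is a basis of the span of those w, then
r = sum c_i b_i with sum c_i = 1, and the integral Gram matrix G satisfies G c = |r|^2 (1, ..., 1).
Multiplying by the adjugate and summing gives det G = |r|^2 N, where N is the sum of the entries of
adj G. As det G is a non-zero integer, |r|^2 >= 1 / |N|, and N is bounded by Leibniz' formula.

Upper bound. Two finite sets in parallel hyperplanes span a polytope of which each side is a face,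
so it suffices to find 0/1 points A in {u . x = c + 1} and B in {u . x = c} whose convex hulls are
exponentially close in d. Two new coordinates e, f halve the distance: take A + e and A + f against
A and B + e + f. If p and q are close in the hulls of A and B, then p + (e + f) / 2 and
(p + (q + e + f)) / 2 differ by (p - q) / 2, and the functional becomes 2 u + e + f. The resulting
2^(-(d-1)/2) beats (k sqrt d)^(-sqrt d) for large d.
*)
theory Submission
  imports Defs "Jordan_Normal_Form.Determinant" "HOL-Real_Asymp.Real_Asymp"
begin

no_notation scalar_prod (infix "\<bullet>" 70)

section \<open>Determinants and linear systems with integer entries\<close>

lemma det_in_Ints:
  fixes A :: "real Matrix.mat"
  assumes A: "A \<in> carrier_mat n n" and int: "\<And>i j. i < n \<Longrightarrow> j < n \<Longrightarrow> A $$ (i, j) \<in> \<int>"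
  shows "Determinant.det A \<in> \<int>"
  unfolding det_def'[OF A]
proof (intro Ints_sum Ints_mult Ints_prod)
  fix p i assume "p \<in> {p. p permutes {0..<n}}" "i \<in> {0..<n}"
  then show "A $$ (i, p i) \<in> \<int>"
    using int permutes_in_image[of p "{0..<n}" i] by auto
qed (auto simp: sign_def)

lemma abs_det_le_fact:
  fixes A :: "real Matrix.mat"
  assumes A: "A \<in> carrier_mat n n" and le: "\<And>i j. i < n \<Longrightarrow> j < n \<Longrightarrow> \<bar>A $$ (i, j)\<bar> \<le> M"
  shows "\<bar>Determinant.det A\<bar> \<le> fact n * M ^ n"
proof -
  have "\<bar>Determinant.det A\<bar> \<le> (\<Sum>p | p permutes {0..<n}. M ^ n)"
    unfolding det_def'[OF A]
  proof (rule order_trans[OF sum_abs sum_mono])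
    fix p assume "p \<in> {p. p permutes {0..<n}}"
    then have p: "p i < n" if "i < n" for i
      using permutes_in_image[of p "{0..<n}" i] that by auto
    have "\<bar>signof p * (\<Prod>i = 0..<n. A $$ (i, p i))\<bar> = (\<Prod>i = 0..<n. \<bar>A $$ (i, p i)\<bar>)"
      by (simp add: abs_mult abs_prod sign_def)
    also have "\<dots> \<le> (\<Prod>i = 0..<n. M)"
      using le p by (intro prod_mono) auto
    finally show "\<bar>signof p * (\<Prod>i = 0..<n. A $$ (i, p i))\<bar> \<le> M ^ n"
      by simp
  qed
  also have "\<dots> = fact n * M ^ n"
    using card_permutations[OF refl, of "{0..<n}"] by simp
  finally show ?thesis .
qed

text \<open>Multiplying the system by the adjugate and summing the rows gives
  \<open>det = s * N\<close>, where \<open>N\<close> is the sum of the adjugate's entries.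
  Injectivity and integrality give a determinant of absolute value at least 1, and each of the
  \<open>n^2\<close> cofactors is a minor of size \<open>n - 1\<close>. The matrix is passed as a
  function, which keeps matrix types inside the proof.\<close>

lemma integer_system_lower_bound:
  fixes g :: "nat \<Rightarrow> nat \<Rightarrow> real" and c :: "nat \<Rightarrow> real"
  assumes int: "\<And>i j. i < n \<Longrightarrow> j < n \<Longrightarrow> g i j \<in> \<int>"
    and le: "\<And>i j. i < n \<Longrightarrow> j < n \<Longrightarrow> \<bar>g i j\<bar> \<le> M"
    and inj: "\<And>v. (\<And>i. i < n \<Longrightarrow> (\<Sum>j<n. g i j * v j) = 0) \<Longrightarrow> (\<And>i. i < n \<Longrightarrow> v i = 0)"
    and sol: "\<And>i. i < n \<Longrightarrow> (\<Sum>j<n. g i j * c j) = s"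
    and sum1: "(\<Sum>j<n. c j) = 1"
  shows "1 \<le> \<bar>s\<bar> * (real n * fact n * M ^ (n - 1))"
proof -
  \<comment> \<open>An empty sum is not 1. Positivity lets \<open>n * fact (n - 1)\<close> become
    \<open>fact n\<close> at the end.\<close>
  have n: "n > 0" using sum1 by (cases n) auto
  define A where "A = Matrix.mat n n (\<lambda>(i, j). g i j)"
  have A: "A \<in> carrier_mat n n" by (simp add: A_def)
  have Ag: "A $$ (i, j) = g i j" if "i < n" "j < n" for i j
    using that by (simp add: A_def)
  define B where "B = adj_mat A"
  have B: "B \<in> carrier_mat n n" unfolding B_def by (rule adj_mat(1)[OF A])
  have Ble: "\<bar>B $$ (i, j)\<bar> \<le> fact (n - 1) * M ^ (n - 1)" if ij: "i < n" "j < n" for i j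
  proof -
    \<comment> \<open>The adjugate is the transpose of the cofactor matrix, so row \<open>j\<close>
      and column \<open>i\<close> are deleted.\<close>
    have "\<bar>Determinant.det (mat_delete A j i)\<bar> \<le> fact (n - 1) * M ^ (n - 1)"
    proof (rule abs_det_le_fact[OF mat_delete_carrier[OF A]])
      fix a b assume ab: "a < n - 1" "b < n - 1"
      then have "mat_delete A j i $$ (a, b) = A $$ (if a < j then a else Suc a, if b < i then b else Suc b)"
        using A by (simp add: mat_delete_def)
      then show "\<bar>mat_delete A j i $$ (a, b)\<bar> \<le> M"
        using ab le by (simp add: Ag)
    qed
    then show ?thesis
      using ij A by (simp add: B_def adj_mat_def cofactor_def abs_mult power_abs)
  qed
  have BA: "(\<Sum>j<n. B $$ (i, j) * g j l) = (if i = l then Determinant.det A else 0)"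
    if il: "i < n" "l < n" for i l
  proof -
    have "(B * A) $$ (i, l) = (\<Sum>j<n. B $$ (i, j) * g j l)"
      using A B il by (auto simp: scalar_prod_def Ag atLeast0LessThan intro!: sum.cong)
    moreover have "(B * A) $$ (i, l) = (if i = l then Determinant.det A else 0)"
      unfolding B_def adj_mat(3)[OF A] using il by simp
    ultimately show ?thesis by simp
  qed
  have "Determinant.det A \<noteq> 0"
  proof
    assume "Determinant.det A = 0"
    then obtain v where v: "v \<in> carrier_vec n" "v \<noteq> 0\<^sub>v n" "A *\<^sub>v v = 0\<^sub>v n"
      using det_0_iff_vec_prod_zero[OF A] by blast
    have "(\<Sum>j<n. g i j * vec_index v j) = 0" if "i < n" for i
    proof -
      have "(\<Sum>j<n. g i j * vec_index v j) = vec_index (A *\<^sub>v v) i"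
        using A v(1) that by (auto simp: scalar_prod_def Ag atLeast0LessThan intro!: sum.cong)
      then show ?thesis using that v(3) by simp
    qed
    from inj[OF this] have "vec_index v i = 0" if "i < n" for i using that by blast
    then have "v = 0\<^sub>v n" using v(1) by (intro eq_vecI) auto
    with v(2) show False by simp
  qed
  moreover have "Determinant.det A \<in> \<int>"
    using det_in_Ints[OF A] int by (simp add: Ag)
  ultimately have "1 \<le> \<bar>Determinant.det A\<bar>"
    by (metis Ints_nonzero_abs_ge1)
  \<comment> \<open>The condition that the \<open>c l\<close> sum to 1 enters here: the determinant
    is spread over the identity matrix, scaled by it, which is then rewritten as
    \<open>B * A\<close>.\<close>
  also have "Determinant.det A = (\<Sum>i<n. \<Sum>l<n. (if i = l then Determinant.det A else 0) * c l)"
    using sum1 by (simp add: if_distrib if_distribR sum.delta' flip: sum_distrib_left cong: if_cong)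
  also have "\<dots> = (\<Sum>i<n. \<Sum>l<n. \<Sum>j<n. B $$ (i, j) * (g j l * c l))"
    by (intro sum.cong refl) (simp add: BA[symmetric] sum_distrib_right mult.assoc)
  also have "\<dots> = (\<Sum>i<n. \<Sum>j<n. B $$ (i, j) * (\<Sum>l<n. g j l * c l))"
    by (subst sum.swap) (simp add: sum_distrib_left)
  also have "\<dots> = (\<Sum>i<n. \<Sum>j<n. B $$ (i, j) * s)"
    by (intro sum.cong refl) (simp add: sol)
  also have "\<dots> = s * (\<Sum>i<n. \<Sum>j<n. B $$ (i, j))"
    by (simp add: sum_distrib_left mult.commute)
  also have "\<bar>\<dots>\<bar> \<le> \<bar>s\<bar> * (\<Sum>i<n. \<Sum>j<n. fact (n - 1) * M ^ (n - 1))"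
    unfolding abs_mult
    by (intro mult_left_mono order_trans[OF sum_abs] sum_mono) (use Ble in auto)
  also have "\<dots> = \<bar>s\<bar> * (real n * fact n * M ^ (n - 1))"
    using n by (simp add: fact_reduce)
  finally show ?thesis .
qed

text \<open>Geometrically, \<open>r\<close> is the foot of the perpendicular from 0 to the affine
  hull of \<open>B\<close>. Its coordinates in \<open>B\<close> solve a system with the Gram matrix
  and the constant right-hand side \<open>r \<bullet> r\<close>.\<close>

lemma span_equidistant_lower_bound:
  fixes B :: "'a::real_inner set"
  assumes fin: "finite B" and ind: "independent B"
    and int: "\<And>v w. v \<in> B \<Longrightarrow> w \<in> B \<Longrightarrow> v \<bullet> w \<in> \<int>"
    and le: "\<And>v w. v \<in> B \<Longrightarrow> w \<in> B \<Longrightarrow> \<bar>v \<bullet> w\<bar> \<le> M"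
    and r: "r \<in> span B" "r \<noteq> 0" "\<And>v. v \<in> B \<Longrightarrow> v \<bullet> r = r \<bullet> r"
  shows "1 \<le> (r \<bullet> r) * (real (card B) * fact (card B) * M ^ (card B - 1))"
proof -
  obtain h where h: "bij_betw h {0..<card B} B"
    using ex_bij_betw_nat_finite[OF fin] by blast
  define n where "n = card B"
  have h: "bij_betw h {..<n} B" using h by (simp add: n_def atLeast0LessThan)
  have hB: "h i \<in> B" if "i < n" for i using bij_betwE[OF h] that by auto
  obtain c where c: "r = (\<Sum>v\<in>B. c v *\<^sub>R v)"
    using r(1) by (auto simp: span_finite[OF fin])
  have rn: "r = (\<Sum>i<n. c (h i) *\<^sub>R h i)"
    unfolding c by (rule sum.reindex_bij_betw[OF h, symmetric])
  have "1 \<le> \<bar>r \<bullet> r\<bar> * (real n * fact n * M ^ (n - 1))"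
  proof (rule integer_system_lower_bound[where g = "\<lambda>i j. h i \<bullet> h j" and c = "\<lambda>i. c (h i)"])
    \<comment> \<open>The Gram matrix is injective: a kernel vector yields a combination
      \<open>x\<close> orthogonal to every \<open>h j\<close>, hence to itself, so
      \<open>x = 0\<close> and independence applies.\<close>
    fix v i assume v: "\<And>i. i < n \<Longrightarrow> (\<Sum>j<n. h i \<bullet> h j * v j) = 0" and i: "i < n"
    define x where "x = (\<Sum>j<n. v j *\<^sub>R h j)"
    have hx: "h i \<bullet> x = 0" if "i < n" for i
      using v[OF that] by (simp add: x_def inner_sum_right mult.commute)
    have "x \<bullet> x = (\<Sum>j<n. v j * (h j \<bullet> x))"
      by (subst (1) x_def) (simp add: inner_sum_left)
    then have "x = 0" using hx by simp
    \<comment> \<open>Independence speaks of coefficients indexed by \<open>B\<close>, so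
      \<open>v\<close> is carried over along the inverse of \<open>h\<close>.\<close>
    define w where "w = (\<lambda>b. v (inv_into {..<n} h b))"
    have inv: "inv_into {..<n} h (h j) = j" if "j < n" for j
      using h that by (simp add: bij_betw_inv_into_left)
    have "(\<Sum>b\<in>B. w b *\<^sub>R b) = (\<Sum>j<n. w (h j) *\<^sub>R h j)"
      by (rule sum.reindex_bij_betw[OF h, symmetric])
    also have "\<dots> = x" unfolding x_def w_def by (intro sum.cong) (auto simp: inv)
    finally have "(\<Sum>b\<in>B. w b *\<^sub>R b) = 0" using \<open>x = 0\<close> by simp
    then have "w (h i) = 0"
      using independentD[OF ind fin subset_refl] hB[OF i] by blast
    then show "v i = 0" using i by (simp add: w_def inv)
  next
    fix i assume "i < n"
    have "(\<Sum>j<n. h i \<bullet> h j * c (h j)) = h i \<bullet> r"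
      by (subst rn) (simp add: inner_sum_right mult.commute)
    then show "(\<Sum>j<n. h i \<bullet> h j * c (h j)) = r \<bullet> r" using r(3) hB \<open>i < n\<close> by simp
  next
    \<comment> \<open>Pairing \<open>r\<close> with its own expansion gives
      \<open>r \<bullet> r\<close> times the sum of the coefficients; as \<open>r\<close> is
      non-zero, that sum is 1.\<close>
    have "r \<bullet> r = (\<Sum>j<n. c (h j) * (h j \<bullet> r))"
      by (subst (1) rn) (simp add: inner_sum_left)
    also have "\<dots> = (\<Sum>j<n. c (h j)) * (r \<bullet> r)"
      using r(3) hB by (simp add: sum_distrib_right)
    finally show "(\<Sum>j<n. c (h j)) = 1" using r(2) by simp
  qed (use int le hB in auto)
  then show ?thesis by (simp add: n_def)
qed

section \<open>Finitely generated convex hulls: least norm, vertices and faces\<close>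

text \<open>The space may be infinite-dimensional, so the minimum is attained by compactness of the
  hull of a finite set. The last property is the variational inequality: otherwise a small move from
  \<open>r\<close> towards \<open>x\<close> would shorten \<open>r\<close>.\<close>

lemma convex_hull_min_norm:
  fixes W :: "'a::real_inner set"
  assumes "finite W" "W \<noteq> {}"
  obtains r where "r \<in> convex hull W" "\<And>x. x \<in> convex hull W \<Longrightarrow> norm r \<le> norm x"
    "\<And>x. x \<in> convex hull W \<Longrightarrow> r \<bullet> r \<le> x \<bullet> r"
proof -
  have "\<exists>r\<in>convex hull W. \<forall>x\<in>convex hull W. norm r \<le> norm x"
    using assms by (intro continuous_attains_inf finite_imp_compact_convex_hull continuous_intros) auto
  then obtain r where r: "r \<in> convex hull W" "\<And>x. x \<in> convex hull W \<Longrightarrow> norm r \<le> norm x"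
    by blast
  have "r \<bullet> r \<le> x \<bullet> r" if x: "x \<in> convex hull W" for x
  proof (rule ccontr)
    assume "\<not> r \<bullet> r \<le> x \<bullet> r"
    then have "r \<bullet> (r - x) > 0" by (simp add: inner_diff_right inner_commute)
    from closer_points_lemma[OF this] obtain u where
      u: "u > 0" "\<And>v. v > 0 \<Longrightarrow> v \<le> u \<Longrightarrow> norm (v *\<^sub>R (r - x) - r) < norm r" by blast
    \<comment> \<open>Capping the step at 1 keeps the moved point on the segment from
      \<open>r\<close> to \<open>x\<close>.\<close>
    define v where "v = min u 1"
    have v: "0 < v" "v \<le> u" "v \<le> 1" using u by (auto simp: v_def)
    have "(1 - v) *\<^sub>R r + v *\<^sub>R x \<in> convex hull W"
      using v r x by (intro convexD) auto
    from r(2)[OF this] have "norm r \<le> norm (v *\<^sub>R (r - x) - r)"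
      by (subst norm_minus_cancel[symmetric]) (simp add: algebra_simps)
    with u(2)[OF v(1,2)] show False by simp
  qed
  with r that show ?thesis by blast
qed

text \<open>In a generating set of least cardinality no point lies in the hull of the others, so
  each is extreme; conversely every generating set contains all extreme points.\<close>

lemma polytope_vertices:
  fixes P :: "'a::real_vector set"
  assumes "polytope P"
  shows "finite (vertices P)" "convex hull (vertices P) = P"
proof -
  define Q where "Q = (\<lambda>S. finite S \<and> P = convex hull S)"
  have "\<exists>S. Q S" using assms by (simp add: polytope_def Q_def)
  then obtain S where S: "Q S" "\<And>T. Q T \<Longrightarrow> card S \<le> card T"
    using ex_has_least_nat[of Q _ card] by blast
  have fS: "finite S" and PS: "P = convex hull S" using S(1) by (auto simp: Q_def)
  have "a \<in> vertices P" if a: "a \<in> S" for a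
  proof -
    have ins: "insert a (S - {a}) = S" using a by blast
    have "a \<notin> convex hull (S - {a})"
    proof
      assume "a \<in> convex hull (S - {a})"
      from hull_redundant[OF this] have "Q (S - {a})"
        using fS PS unfolding ins Q_def by simp
      from S(2)[OF this] card_Diff1_less[OF fS a] show False by simp
    qed
    from extreme_point_of_convex_hull_insert[OF _ this] fS show ?thesis
      unfolding ins PS vertices_def by simp
  qed
  moreover have "vertices P \<subseteq> S"
    unfolding PS vertices_def by (rule extreme_points_of_convex_hull)
  ultimately have "vertices P = S" by blast
  then show "finite (vertices P)" "convex hull (vertices P) = P" using fS PS by auto
qed

text \<open>Induction removes a generator \<open>v\<close> outside \<open>F\<close>. A point of
  \<open>F\<close> using \<open>v\<close> with positive weight would lie strictly between
  \<open>v\<close> and a point of the hull of the rest, which would force \<open>v\<close> into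
  \<open>F\<close>.\<close>

lemma face_of_convex_hull_Int:
  fixes S :: "'a::real_vector set"
  assumes "finite S" "F face_of convex hull S"
  shows "F \<subseteq> convex hull (S \<inter> F)"
  using assms
proof (induction S arbitrary: F rule: finite_psubset_induct)
  case (psubset S)
  note Fsub = face_of_imp_subset[OF psubset.prems]
  show ?case
  proof (cases "S \<subseteq> F")
    case True
    then show ?thesis using Fsub by (simp add: Int_absorb2)
  next
    case False
    then obtain v where v: "v \<in> S" "v \<notin> F" by blast
    define T where "T = S - {v}"
    have T: "T \<subset> S" "insert v T = S" using v by (auto simp: T_def)
    have sub: "convex hull T \<subseteq> convex hull S" using T by (intro hull_mono) blast
    have face: "F \<inter> convex hull T face_of convex hull T"
      using face_of_slice[OF psubset.prems convex_convex_hull[of T]] sub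
      by (simp add: Int_absorb1)
    have "F \<subseteq> convex hull T"
    proof
      fix x assume x: "x \<in> F"
      then have xS: "x \<in> convex hull (insert v T)" using Fsub T by auto
      then have "T \<noteq> {}" using x v by auto
      with xS obtain a b y where ab: "a \<ge> 0" "b \<ge> 0" "a + b = 1" "y \<in> convex hull T"
        "x = a *\<^sub>R v + b *\<^sub>R y"
        using convex_hull_insert[of T v] by blast
      have "a = 0"
      proof (rule ccontr)
        assume "a \<noteq> 0"
        have "b \<noteq> 0" using ab x v by auto
        have "v \<noteq> y" using ab x v by (metis scaleR_collapse scaleR_left_distrib scaleR_one)
        have "b < 1" using \<open>a \<noteq> 0\<close> ab by linarith
        then have "x \<in> open_segment v y"
          using ab \<open>b \<noteq> 0\<close> \<open>v \<noteq> y\<close> unfolding in_segment(2)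
          by (intro conjI exI[of _ b]) (auto simp: eq_diff_eq[symmetric] simp flip: scaleR_left_distrib)
        moreover have "v \<in> convex hull S" "y \<in> convex hull S"
          using v hull_inc ab(4) sub by auto
        ultimately show False using face_ofD[OF psubset.prems _ _ _ x] v by blast
      qed
      then show "x \<in> convex hull T" using ab by simp
    qed
    then have "F \<subseteq> convex hull (T \<inter> (F \<inter> convex hull T))"
      using psubset.IH[OF T(1) face] by blast
    also have "\<dots> \<subseteq> convex hull (S \<inter> F)" using T by (intro hull_mono) blast
    finally show ?thesis .
  qed
qed

text \<open>For disjointness: the intersection is a face of the hull of
  \<open>vertices P - F\<close>, so it is generated by those of these vertices that lie in
  \<open>F\<close>, and there are none.\<close>

lemma proper_face_of_polytope:
  fixes P :: "'a::real_vector set"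
  assumes P: "polytope P" and F: "F \<in> proper_faces P"
  shows "F = convex hull (vertices P \<inter> F)" "vertices P - F \<noteq> {}"
    "F \<inter> convex hull (vertices P - F) = {}"
proof -
  note V = polytope_vertices[OF P]
  have face: "F face_of convex hull (vertices P)" "F \<noteq> {}" "F \<noteq> P"
    using F V by (auto simp: proper_faces_def)
  have conv: "convex F" using face(1) by (rule face_of_imp_convex)
  show "F = convex hull (vertices P \<inter> F)"
    using face_of_convex_hull_Int[OF V(1) face(1)] conv by (simp add: subset_antisym hull_minimal)
  show "vertices P - F \<noteq> {}"
  proof
    assume "vertices P - F = {}"
    then have "convex hull (vertices P) \<subseteq> F" using conv by (intro hull_minimal) auto
    then show False using face_of_imp_subset[OF face(1)] face(3) V(2) by auto
  qed
  let ?C = "convex hull (vertices P - F)"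
  have "?C \<subseteq> convex hull (vertices P)" by (intro hull_mono) blast
  then have "F \<inter> ?C face_of ?C"
    using face_of_slice[OF face(1) convex_convex_hull[of "vertices P - F"]]
    by (simp add: Int_absorb1)
  from face_of_convex_hull_Int[OF _ this] V(1)
  have "F \<inter> ?C \<subseteq> convex hull ((vertices P - F) \<inter> (F \<inter> ?C))" by simp
  also have "(vertices P - F) \<inter> (F \<inter> ?C) = {}" by blast
  finally show "F \<inter> ?C = {}" by simp
qed

section \<open>Facial distance as a minimum over a finite non-empty family\<close>

lemma finite_proper_faces:
  fixes P :: "'a::real_vector set"
  assumes "polytope P"
  shows "finite (proper_faces P)"
proof (rule finite_subset)
  show "proper_faces P \<subseteq> (hull) convex ` Pow (vertices P)"
    using proper_face_of_polytope(1)[OF assms] by blast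
qed (simp add: polytope_vertices(1)[OF assms])

lemma proper_faces_nonempty:
  fixes P :: "'a::real_vector set"
  assumes "card (vertices P) \<ge> 2"
  shows "proper_faces P \<noteq> {}"
proof -
  obtain v where v: "v \<in> vertices P" using assms by fastforce
  have "P \<noteq> {v}"
  proof
    assume "P = {v}"
    then have "vertices P = {v}" by (auto simp: vertices_def)
    then show False using assms by simp
  qed
  then have "{v} \<in> proper_faces P"
    using v by (auto simp: proper_faces_def vertices_def face_of_singleton)
  then show ?thesis by blast
qed

lemma facial_distance_le_setdist:
  assumes "polytope P" "F \<in> proper_faces P"
  shows "facial_distance P \<le> setdist F (convex hull (vertices P - F))"
  unfolding facial_distance_def
  using assms finite_proper_faces by (intro Min_le) auto

lemma facial_distance_ge:
  assumes "polytope P" "card (vertices P) \<ge> 2"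
    and "\<And>F. F \<in> proper_faces P \<Longrightarrow> \<delta> \<le> setdist F (convex hull (vertices P - F))"
  shows "\<delta> \<le> facial_distance P"
  unfolding facial_distance_def
  using assms finite_proper_faces[OF assms(1)] proper_faces_nonempty[OF assms(2)]
  by (subst Min_ge_iff) auto

section \<open>Lower bound for lattice polytopes\<close>

lemma inner_euclidean_subspace:
  assumes "x \<in> euclidean_subspace d"
  shows "x \<bullet> y = (\<Sum>i<d. Poly_Mapping.lookup x i * Poly_Mapping.lookup y i)"
  using inner_poly_mapping_superset[of "{..<d}" x y] assms by (simp add: euclidean_subspace_def)

text \<open>This bounds the size of an independent set in the subspace by \<open>d\<close>.\<close>

lemma euclidean_subspace_subset_span:
  "euclidean_subspace d \<subseteq> span ((\<lambda>i. Poly_Mapping.single i 1) ` {..<d})"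
proof
  fix x assume x: "x \<in> euclidean_subspace d"
  have "x = (\<Sum>i<d. Poly_Mapping.lookup x i *\<^sub>R Poly_Mapping.single i 1)"
  proof (rule poly_mapping_eqI)
    fix j
    have "Poly_Mapping.lookup x j = 0" if "\<not> j < d"
      using x that
      by (auto simp: euclidean_subspace_def in_keys_iff simp del: lookup_not_eq_zero_eq_in_keys)
    then show "Poly_Mapping.lookup x j =
      Poly_Mapping.lookup (\<Sum>i<d. Poly_Mapping.lookup x i *\<^sub>R Poly_Mapping.single i 1) j"
      by (simp add: lookup_sum lookup_single when_def if_distrib sum.delta cong: if_cong)
  qed
  then show "x \<in> span ((\<lambda>i. Poly_Mapping.single i 1) ` {..<d})"
    by (metis (no_types, lifting) imageI span_base span_scale span_sum)
qed

lemma euclidean_subspace_diff: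
  "x \<in> euclidean_subspace d \<Longrightarrow> y \<in> euclidean_subspace d \<Longrightarrow> x - y \<in> euclidean_subspace d"
  using keys_diff[of x y] by (auto simp: euclidean_subspace_def)

text \<open>The shortest vector \<open>r\<close> of the hull lies on the face where
  \<open>r \<bullet> w = r \<bullet> r\<close>. A basis chosen among the lattice vectors of that
  face has at most \<open>d\<close> elements and an integral Gram matrix.\<close>

lemma integer_hull_norm_lower_bound:
  assumes fin: "finite W" and W: "W \<subseteq> integer_lattice d"
    and le: "\<And>w i. w \<in> W \<Longrightarrow> i < d \<Longrightarrow> \<bar>Poly_Mapping.lookup w i\<bar> \<le> real k"
    and k: "k \<ge> 1" and z: "0 \<notin> convex hull W" and x: "x \<in> convex hull W"
  shows "1 / (real k * real d) ^ (2 * d) \<le> norm x"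
proof -
  have "W \<noteq> {}" using x by auto
  then obtain r where r: "r \<in> convex hull W" "\<And>x. x \<in> convex hull W \<Longrightarrow> norm r \<le> norm x"
    "\<And>x. x \<in> convex hull W \<Longrightarrow> r \<bullet> r \<le> x \<bullet> r"
    using convex_hull_min_norm[OF fin] by blast
  have r0: "r \<noteq> 0" using r(1) z by auto
  define W0 where "W0 = W \<inter> {w. r \<bullet> w = r \<bullet> r}"
  let ?F = "convex hull W \<inter> {w. r \<bullet> w = r \<bullet> r}"
  have "?F face_of convex hull W"
    using r(3) by (intro face_of_Int_supporting_hyperplane_ge) (auto simp: inner_commute)
  from face_of_convex_hull_Int[OF fin this] r(1)
  have "r \<in> convex hull (W \<inter> ?F)" by blast
  also have "W \<inter> ?F = W0" using hull_subset[of W convex] by (auto simp: W0_def)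
  finally have rW0: "r \<in> span W0" using convex_hull_subset_span by blast
  obtain B where B: "B \<subseteq> W0" "independent B" "W0 \<subseteq> span B"
    using maximal_independent_subset[of W0] by blast
  have rB: "r \<in> span B" using rW0 B(3) span_minimal[OF B(3) subspace_span] by auto
  define n where "n = card B"
  have BW: "B \<subseteq> W" using B by (auto simp: W0_def)
  have BE: "B \<subseteq> euclidean_subspace d" using BW W by (auto simp: integer_lattice_def)
  have finB: "finite B" using BW fin finite_subset by blast
  have "n \<le> card ((\<lambda>i. Poly_Mapping.single i (1::real)) ` {..<d})"
    unfolding n_def using BE euclidean_subspace_subset_span B(2)
    by (intro independent_span_bound[THEN conjunct2]) auto
  also have "\<dots> \<le> d" using card_image_le[of "{..<d}"] by simp
  finally have nd: "n \<le> d" .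
  have n0: "n \<noteq> 0" using rB r0 finB by (auto simp: n_def)
  \<comment> \<open>An inner product has \<open>d\<close> terms, each of absolute value at most
    \<open>k^2\<close>.\<close>
  define M where "M = (real k)\<^sup>2 * real d"
  have "1 \<le> (r \<bullet> r) * (real n * fact n * M ^ (n - 1))"
    unfolding n_def
  proof (rule span_equidistant_lower_bound[OF finB B(2) _ _ rB r0])
    fix v w assume vw: "v \<in> B" "w \<in> B"
    note inn = inner_euclidean_subspace[OF subsetD[OF BE vw(1)], of w]
    show "v \<bullet> w \<in> \<int>"
      unfolding inn using BW W vw by (intro Ints_sum Ints_mult) (auto simp: integer_lattice_def)
    have "\<bar>v \<bullet> w\<bar> \<le> (\<Sum>i<d. real k * real k)"
      unfolding inn using le BW vw
      by (intro order_trans[OF sum_abs] sum_mono) (auto simp: abs_mult intro!: mult_mono)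
    then show "\<bar>v \<bullet> w\<bar> \<le> M" by (simp add: M_def power2_eq_square mult.commute)
  next
    fix v assume "v \<in> B"
    then show "v \<bullet> r = r \<bullet> r" using B(1) by (auto simp: W0_def inner_commute)
  qed
  \<comment> \<open>The determinant argument bounds the squared norm, so the target is squared too.
    The factors \<open>n\<close> and \<open>fact n\<close> are each at most \<open>d^d\<close> and
    \<open>M^(n - 1)\<close> is at most \<open>k^(2 d) d^d\<close>; the product
    \<open>d^(3 d) k^(2 d)\<close> is rounded up to \<open>(k d)^(4 d)\<close>.\<close>
  also have "\<dots> \<le> (norm r)\<^sup>2 * ((real k * real d) ^ (2 * d))\<^sup>2"
  proof -
    have d1: "1 \<le> real d" and k1: "1 \<le> real k" using nd n0 k by auto
    have M1: "1 \<le> M" unfolding M_def using d1 k1 by (metis mult_mono' mult_1 one_le_power zero_le_one)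
    have "fact n \<le> (real n ^ n)" using fact_le_power[of n] by simp
    also have "\<dots> \<le> real d ^ d" using nd n0 d1
      by (meson order_trans power_increasing power_mono of_nat_0_le_iff of_nat_le_iff)
    finally have f: "fact n \<le> real d ^ d" .
    have "real n \<le> real d ^ d"
      using nd n0 d1 by (meson order_trans of_nat_le_iff self_le_power order_less_le_trans neq0_conv)
    then have "real n * fact n * M ^ (n - 1) \<le> real d ^ d * real d ^ d * M ^ d"
      using f M1 nd d1 by (intro mult_mono power_increasing) auto
    also have "\<dots> = real d ^ (3 * d) * real k ^ (2 * d)"
      by (simp add: M_def power_mult_distrib power_add[symmetric] numeral_3_eq_3 mult_ac
          flip: power_mult)
    also have "\<dots> \<le> real d ^ (4 * d) * real k ^ (4 * d)"
      using d1 k1 by (intro mult_mono power_increasing) auto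
    also have "\<dots> = ((real k * real d) ^ (2 * d))\<^sup>2"
      by (simp add: power_mult_distrib mult_ac flip: power_mult)
    finally show ?thesis unfolding dot_square_norm by (intro mult_left_mono) auto
  qed
  finally have "1 \<le> (norm r * (real k * real d) ^ (2 * d))\<^sup>2" by (simp add: power_mult_distrib)
  then have "1 \<le> norm r * (real k * real d) ^ (2 * d)"
    by (intro power2_le_imp_le[of 1]) auto
  moreover have "(real k * real d) ^ (2 * d) > 0" using k nd n0 by simp
  ultimately have "1 / (real k * real d) ^ (2 * d) \<le> norm r" by (simp add: divide_le_eq)
  also have "\<dots> \<le> norm x" using r(2) x by blast
  finally show ?thesis .
qed

text \<open>The difference of two hulls is the hull of the differences; disjointness means that it
  misses 0. Differences of points of the cube have entries between \<open>-k\<close> and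
  \<open>k\<close>.\<close>

lemma setdist_lattice_hulls_ge:
  assumes fin: "finite A" "finite B" and ne: "A \<noteq> {}" "B \<noteq> {}"
    and A: "A \<subseteq> integer_lattice d \<inter> hypercube d k" and B: "B \<subseteq> integer_lattice d \<inter> hypercube d k"
    and disj: "convex hull A \<inter> convex hull B = {}" and k: "k \<ge> 1"
  shows "1 / (real k * real d) ^ (2 * d) \<le> setdist (convex hull A) (convex hull B)"
proof (rule le_setdistI)
  fix x y assume xy: "x \<in> convex hull A" "y \<in> convex hull B"
  define W where "W = A + uminus ` B"
  have W: "convex hull W = convex hull A + uminus ` (convex hull B)"
    unfolding W_def convex_hull_set_plus
    by (simp add: convex_hull_linear_image linear_iff)
  have Wab: "\<exists>a\<in>A. \<exists>b\<in>B. w = a - b" if "w \<in> W" for w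
    using that by (fastforce simp: W_def elim!: set_plus_elim)
  have "1 / (real k * real d) ^ (2 * d) \<le> norm (x - y)"
  proof (rule integer_hull_norm_lower_bound[OF _ _ _ k])
    show "finite W" unfolding W_def using fin by (intro finite_set_plus) auto
    show "W \<subseteq> integer_lattice d"
    proof
      fix w assume "w \<in> W"
      from Wab[OF this] A B show "w \<in> integer_lattice d"
        by (force simp: integer_lattice_def lookup_minus euclidean_subspace_diff)
    qed
    show "\<bar>Poly_Mapping.lookup w i\<bar> \<le> real k" if w: "w \<in> W" and i: "i < d" for w i
    proof -
      obtain a b where ab: "a \<in> A" "b \<in> B" "w = a - b" using Wab[OF w] by blast
      have "a \<in> hypercube d k" "b \<in> hypercube d k" using ab A B by auto
      then have "0 \<le> Poly_Mapping.lookup a i" "Poly_Mapping.lookup a i \<le> k"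
        "0 \<le> Poly_Mapping.lookup b i" "Poly_Mapping.lookup b i \<le> k"
        using i by (auto simp: hypercube_def)
      then show ?thesis unfolding ab(3) lookup_minus by linarith
    qed
    show "0 \<notin> convex hull W"
      using disj unfolding W by (force elim!: set_plus_elim)
    have "x + (- y) \<in> convex hull W" unfolding W using xy by (intro set_plus_intro) auto
    then show "x - y \<in> convex hull W" by simp
  qed
  then show "1 / (real k * real d) ^ (2 * d) \<le> dist x y" by (simp add: dist_norm)
qed (use ne in auto)

lemma facial_distance_lattice_polytope_ge:
  assumes P: "lattice_polytope d k P" and card: "card (vertices P) \<ge> 2" and k: "k \<ge> 1"
  shows "1 / (real k * real d) ^ (2 * d) \<le> facial_distance P"
proof -
  have poly: "polytope P" using P by (simp add: lattice_polytope_def)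
  have V: "vertices P \<subseteq> integer_lattice d \<inter> hypercube d k"
    using P by (auto simp: lattice_polytope_def vertices_def extreme_point_of_def)
  show ?thesis
  proof (rule facial_distance_ge[OF poly card])
    fix F assume F: "F \<in> proper_faces P"
    note face = proper_face_of_polytope[OF poly F]
    have "vertices P \<inter> F \<noteq> {}"
    proof
      assume "vertices P \<inter> F = {}"
      then have "F = {}" using face(1) by simp
      then show False using F by (simp add: proper_faces_def)
    qed
    then have "1 / (real k * real d) ^ (2 * d)
        \<le> setdist (convex hull (vertices P \<inter> F)) (convex hull (vertices P - F))"
      using V face polytope_vertices(1)[OF poly] k by (intro setdist_lattice_hulls_ge) auto
    then show "1 / (real k * real d) ^ (2 * d) \<le> setdist F (convex hull (vertices P - F))"
      using face(1) by simp
  qed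
qed

section \<open>Finiteness of the family of lattice polytopes\<close>

lemma finite_lattice_hypercube: "finite (integer_lattice d \<inter> hypercube d k)"
proof (rule finite_imageD)
  \<comment> \<open>A point is determined by its first \<open>d\<close> coordinates, since all
    others vanish.\<close>
  let ?f = "\<lambda>x. restrict (Poly_Mapping.lookup x) {..<d}"
  show "finite (?f ` (integer_lattice d \<inter> hypercube d k))"
  proof (rule finite_subset)
    show "?f ` (integer_lattice d \<inter> hypercube d k) \<subseteq> (\<Pi>\<^sub>E i\<in>{..<d}. real ` {..k})"
    proof (clarsimp simp: PiE_iff)
      fix x i assume "x \<in> integer_lattice d" "x \<in> hypercube d k" "i < d"
      then have "Poly_Mapping.lookup x i \<in> \<int>" "0 \<le> Poly_Mapping.lookup x i" "Poly_Mapping.lookup x i \<le> k"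
        by (auto simp: integer_lattice_def hypercube_def)
      then obtain m where m: "Poly_Mapping.lookup x i = of_int m" "0 \<le> m" "m \<le> int k"
        by (auto elim!: Ints_cases)
      then show "Poly_Mapping.lookup x i \<in> real ` {..k}"
        by (intro image_eqI[of _ _ "nat m"]) auto
    qed
  qed (auto intro: finite_PiE)
  show "inj_on ?f (integer_lattice d \<inter> hypercube d k)"
  proof (rule inj_onI, rule poly_mapping_eqI)
    fix x y j
    assume x: "x \<in> integer_lattice d \<inter> hypercube d k" and y: "y \<in> integer_lattice d \<inter> hypercube d k"
      and eq: "?f x = ?f y"
    show "Poly_Mapping.lookup x j = Poly_Mapping.lookup y j"
    proof (cases "j < d")
      case True
      then show ?thesis using fun_cong[OF eq, of j] by simp
    next
      case False
      then have "j \<notin> Poly_Mapping.keys x" "j \<notin> Poly_Mapping.keys y"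
        using x y by (auto simp: hypercube_def euclidean_subspace_def)
      then show ?thesis by (simp add: in_keys_iff)
    qed
  qed
qed

text \<open>A polytope is the hull of its vertices, here a subset of a finite set of lattice points.
  This makes the \<open>Min\<close> of the theorem a genuine minimum.\<close>

lemma finite_lattice_polytopes: "finite {P. lattice_polytope d k P}"
proof (rule finite_subset)
  show "{P. lattice_polytope d k P} \<subseteq> (hull) convex ` Pow (integer_lattice d \<inter> hypercube d k)"
  proof clarify
    fix P assume P: "lattice_polytope d k P"
    then have "vertices P \<subseteq> integer_lattice d \<inter> hypercube d k"
      by (auto simp: lattice_polytope_def vertices_def extreme_point_of_def)
    moreover have "P = convex hull (vertices P)"
      using P polytope_vertices(2)[of P] by (simp add: lattice_polytope_def)
    ultimately show "P \<in> (hull) convex ` Pow (integer_lattice d \<inter> hypercube d k)" by blast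
  qed
qed (intro finite_imageI finite_Pow_iff[THEN iffD2] finite_lattice_hypercube)

section \<open>Upper bound: 0/1 polytopes with close opposite faces\<close>

lemma facial_distance_parallel_le:
  fixes A B :: "'a::real_inner set"
  assumes fin: "finite A" "finite B"
    and A: "\<And>x. x \<in> A \<Longrightarrow> u \<bullet> x = c + 1" and B: "\<And>x. x \<in> B \<Longrightarrow> u \<bullet> x = c"
    and p: "p \<in> convex hull A" and q: "q \<in> convex hull B"
  shows "facial_distance (convex hull (A \<union> B)) \<le> dist p q"
    and "card (vertices (convex hull (A \<union> B))) \<ge> 2"
proof -
  define P where "P = convex hull (A \<union> B)"
  have poly: "polytope P" using fin by (auto simp: P_def polytope_def)
  note V = polytope_vertices[OF poly]
  have "convex hull A \<subseteq> {x. u \<bullet> x = c + 1}" "convex hull B \<subseteq> {x. u \<bullet> x = c}"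
    by (intro hull_minimal convex_hyperplane; auto simp: A B)+
  then have up: "u \<bullet> p = c + 1" and uq: "u \<bullet> q = c" using p q by auto
  have pP: "p \<in> P" and qP: "q \<in> P"
    using p q hull_mono[of A "A \<union> B"] hull_mono[of B "A \<union> B"] by (auto simp: P_def)
  have "P \<subseteq> {x. u \<bullet> x \<le> c + 1}" "P \<subseteq> {x. u \<bullet> x \<ge> c}"
    unfolding P_def
    by (intro hull_minimal convex_halfspace_le convex_halfspace_ge; auto simp: A B)+
  then have le: "u \<bullet> x \<le> c + 1" and ge: "u \<bullet> x \<ge> c" if "x \<in> P" for x using that by auto
  have convP: "convex P" by (simp add: P_def)
  define F where "F = P \<inter> {x. u \<bullet> x = c + 1}"
  have "F face_of P"
    unfolding F_def using convP le by (rule face_of_Int_supporting_hyperplane_le)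
  moreover have "p \<in> F" "q \<notin> F" using pP up uq by (auto simp: F_def)
  ultimately have F: "F \<in> proper_faces P" using qP by (auto simp: proper_faces_def)
  have "P \<inter> {x. u \<bullet> x = c} face_of P"
    using convP ge by (rule face_of_Int_supporting_hyperplane_ge)
  \<comment> \<open>Points of \<open>B\<close> may fail to be vertices, so \<open>q\<close> is
    expressed through the vertices of the face at level \<open>c\<close>; none of them lies in
    \<open>F\<close>, which is at level \<open>c + 1\<close>.\<close>
  then have "P \<inter> {x. u \<bullet> x = c} \<subseteq> convex hull (vertices P \<inter> (P \<inter> {x. u \<bullet> x = c}))"
    using face_of_convex_hull_Int[OF V(1)] V(2) by simp
  also have "\<dots> \<subseteq> convex hull (vertices P - F)"
    by (rule hull_mono) (auto simp: F_def)
  finally have "q \<in> convex hull (vertices P - F)" using qP uq by auto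
  with \<open>p \<in> F\<close> have "setdist F (convex hull (vertices P - F)) \<le> dist p q"
    by (rule setdist_le_dist)
  then show "facial_distance (convex hull (A \<union> B)) \<le> dist p q"
    using facial_distance_le_setdist[OF poly F] by (simp add: P_def)
  have "card (vertices P) \<noteq> 0" using V pP by auto
  moreover have "card (vertices P) \<noteq> 1"
  proof
    assume "card (vertices P) = 1"
    then obtain v where "vertices P = {v}" by (auto simp: card_1_singleton_iff)
    then have "P = {v}" using V(2) by simp
    then show False using pP qP up uq by auto
  qed
  ultimately have "card (vertices P) \<ge> 2" by linarith
  then show "card (vertices (convex hull (A \<union> B))) \<ge> 2" by (simp add: P_def)
qed

lemma inner_single_one:
  fixes x :: "'a \<Rightarrow>\<^sub>0 real"
  shows "Poly_Mapping.single i 1 \<bullet> x = Poly_Mapping.lookup x i"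
  by (simp add: inner_poly_mapping_def)

lemma convex_hull_plus_mem:
  "x \<in> convex hull S \<Longrightarrow> e + x \<in> convex hull ((+) e ` S)"
  by (simp add: convex_hull_translation)

text \<open>Each induction step adds two coordinates and halves the distance. Keeping
  \<open>u\<close> in the subspace makes it orthogonal to the coordinates added next.\<close>

lemma close_zero_one_hulls:
  "\<exists>A B u c p q. finite A \<and> finite B \<and>
     A \<union> B \<subseteq> {x \<in> euclidean_subspace (2 * m + 1). \<forall>i. Poly_Mapping.lookup x i \<in> {0, 1}} \<and>
     u \<in> euclidean_subspace (2 * m + 1) \<and>
     (\<forall>x\<in>A. u \<bullet> x = c + 1) \<and> (\<forall>x\<in>B. u \<bullet> x = c) \<and>
     p \<in> convex hull A \<and> q \<in> convex hull B \<and> dist p q = 1 / 2 ^ m"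
proof (induction m)
  case 0
  define e :: "nat \<Rightarrow>\<^sub>0 real" where "e = Poly_Mapping.single 0 1"
  have "e \<bullet> e = 1" "e \<in> euclidean_subspace 1" "\<And>i. Poly_Mapping.lookup e i \<in> {0, 1}"
    unfolding e_def inner_single_one
    by (auto simp: euclidean_subspace_def lookup_single when_def simp del: single_one)
  then show ?case
    by (rule_tac x = "{e}" in exI, rule_tac x = "{0}" in exI, rule_tac x = e in exI,
        rule_tac x = 0 in exI, rule_tac x = e in exI, rule_tac x = 0 in exI)
      (simp add: euclidean_subspace_def norm_eq_sqrt_inner)
next
  case (Suc m)
  define E where "E = euclidean_subspace (2 * m + 1)"
  obtain A B u c p q where fin: "finite A" "finite B"
    and AB: "A \<union> B \<subseteq> {x \<in> E. \<forall>i. Poly_Mapping.lookup x i \<in> {0, 1}}" and u: "u \<in> E"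
    and A: "\<And>x. x \<in> A \<Longrightarrow> u \<bullet> x = c + 1" and B: "\<And>x. x \<in> B \<Longrightarrow> u \<bullet> x = c"
    and p: "p \<in> convex hull A" and q: "q \<in> convex hull B" and pq: "dist p q = 1 / 2 ^ m"
    using Suc.IH unfolding E_def[symmetric] by blast
  \<comment> \<open>The coordinates in use are 0 to \<open>2 * m\<close>, so these are the first two
    free ones.\<close>
  define e :: "nat \<Rightarrow>\<^sub>0 real" where "e = Poly_Mapping.single (2 * m + 1) 1"
  define f :: "nat \<Rightarrow>\<^sub>0 real" where "f = Poly_Mapping.single (2 * m + 2) 1"
  define A' where "A' = (+) e ` A \<union> (+) f ` A"
  define B' where "B' = A \<union> (+) (e + f) ` B"
  \<comment> \<open>Doubling \<open>u\<close> puts \<open>A\<close> two levels above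
    \<open>B\<close>. Adding \<open>e + f\<close> to \<open>B\<close> makes up for this, so
    \<open>B'\<close> is at level \<open>2 * c + 2\<close>, while a single new coordinate puts
    \<open>A'\<close> one level higher.\<close>
  define u' where "u' = 2 *\<^sub>R u + e + f"
  \<comment> \<open>Both midpoints contain \<open>(e + f) / 2\<close>, which cancels in the
    difference and leaves \<open>(p - q) / 2\<close>.\<close>
  define p' where "p' = (1/2) *\<^sub>R (e + p) + (1/2) *\<^sub>R (f + p)"
  define q' where "q' = (1/2) *\<^sub>R p + (1/2) *\<^sub>R (e + f + q)"
  have zero: "Poly_Mapping.lookup x i = 0" if "x \<in> E" "i \<ge> 2 * m + 1" for x i
    using that
    by (auto simp: E_def euclidean_subspace_def in_keys_iff
        simp del: lookup_not_eq_zero_eq_in_keys)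
  have orth: "e \<bullet> x = 0" "f \<bullet> x = 0" "x \<bullet> e = 0" "x \<bullet> f = 0" if "x \<in> E" for x
    using zero[OF that] by (auto simp: e_def f_def inner_single_one inner_commute[of x])
  have ef: "e \<bullet> e = 1" "f \<bullet> f = 1" "e \<bullet> f = 0" "f \<bullet> e = 0"
    by (auto simp: e_def f_def inner_single_one lookup_single)
  have E': "x \<in> euclidean_subspace (2 * Suc m + 1)"
    if "\<And>i. i \<ge> 2 * m + 3 \<Longrightarrow> Poly_Mapping.lookup x i = 0" for x
    unfolding euclidean_subspace_def
  proof (intro CollectI subsetI)
    fix i assume "i \<in> Poly_Mapping.keys x"
    then have "\<not> i \<ge> 2 * m + 3" using that[of i] by (auto simp: in_keys_iff)
    then show "i \<in> {..<2 * Suc m + 1}" by simp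
  qed
  have look: "Poly_Mapping.lookup e i = (if i = 2 * m + 1 then 1 else 0)"
    "Poly_Mapping.lookup f i = (if i = 2 * m + 2 then 1 else 0)" for i
    by (auto simp: e_def f_def lookup_single)
  have "A' \<union> B' \<subseteq> {x \<in> euclidean_subspace (2 * Suc m + 1). \<forall>i. Poly_Mapping.lookup x i \<in> {0, 1}}"
  proof (intro subsetI CollectI conjI allI)
    fix x assume "x \<in> A' \<union> B'"
    then obtain y where y: "y \<in> A \<union> B" "x = e + y \<or> x = f + y \<or> x = y \<or> x = e + f + y"
      by (auto simp: A'_def B'_def)
    then have "y \<in> E" and y01: "\<And>i. Poly_Mapping.lookup y i \<in> {0, 1}" using AB by auto
    note z = zero[OF \<open>y \<in> E\<close>]
    show "x \<in> euclidean_subspace (2 * Suc m + 1)"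
      using y(2) z by (intro E') (auto simp: lookup_add look)
    show "Poly_Mapping.lookup x i \<in> {0, 1}" for i
      using y(2) z[of i] y01[of i] by (auto simp: lookup_add look split: if_splits)
  qed
  moreover have "u' \<in> euclidean_subspace (2 * Suc m + 1)"
  proof (rule E')
    fix i assume "i \<ge> 2 * m + 3"
    then have "i \<noteq> 2 * m + 1" "i \<noteq> 2 * m + 2" "Poly_Mapping.lookup u i = 0"
      using zero[OF u, of i] by auto
    then show "Poly_Mapping.lookup u' i = 0"
      unfolding u'_def lookup_add lookup_scaleR look by simp
  qed
  moreover have "\<forall>x\<in>A'. u' \<bullet> x = (2 * c + 2) + 1" "\<forall>x\<in>B'. u' \<bullet> x = 2 * c + 2"
  proof -
    have ux: "u' \<bullet> x = 2 * (u \<bullet> x)" "u' \<bullet> (e + x) = 2 * (u \<bullet> x) + 1"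
      "u' \<bullet> (f + x) = 2 * (u \<bullet> x) + 1" "u' \<bullet> (e + f + x) = 2 * (u \<bullet> x) + 2" if "x \<in> E" for x
      using orth[OF that] orth[OF u] ef by (simp_all add: u'_def inner_add_left inner_add_right)
    have "x \<in> E" if "x \<in> A \<union> B" for x using AB that by blast
    then show "\<forall>x\<in>A'. u' \<bullet> x = (2 * c + 2) + 1" "\<forall>x\<in>B'. u' \<bullet> x = 2 * c + 2"
      by (auto simp: A'_def B'_def ux A B)
  qed
  moreover have "p' \<in> convex hull A'"
  proof -
    have "e + p \<in> convex hull A'" "f + p \<in> convex hull A'"
      by (rule hull_mono[THEN subsetD, OF _ convex_hull_plus_mem[OF p]], simp add: A'_def)+
    then show ?thesis unfolding p'_def by (intro convexD) auto
  qed
  moreover have "q' \<in> convex hull B'"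
  proof -
    have "p \<in> convex hull B'"
      by (rule hull_mono[THEN subsetD, OF _ p]) (simp add: B'_def)
    moreover have "e + f + q \<in> convex hull B'"
      by (rule hull_mono[THEN subsetD, OF _ convex_hull_plus_mem[OF q]]) (simp add: B'_def)
    ultimately show ?thesis unfolding q'_def by (intro convexD) auto
  qed
  moreover have "dist p' q' = 1 / 2 ^ Suc m"
  proof -
    have "p' = (1/2) *\<^sub>R (e + f) + ((1/2) *\<^sub>R p + (1/2) *\<^sub>R p)"
      unfolding p'_def by (simp only: scaleR_right_distrib ac_simps)
    then have "p' - q' = (1/2) *\<^sub>R (p - q)"
      unfolding q'_def by (simp add: scaleR_right_distrib scaleR_right_diff_distrib)
    then show ?thesis using pq by (simp add: dist_norm)
  qed
  moreover have "finite A'" "finite B'" using fin by (auto simp: A'_def B'_def)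
  ultimately show ?case by blast
qed

lemma convex_hypercube: "convex (hypercube d k)"
proof (rule convexI)
  fix x y and a b :: real
  assume xy: "x \<in> hypercube d k" "y \<in> hypercube d k" and ab: "a \<ge> 0" "b \<ge> 0" "a + b = 1"
  have keys: "Poly_Mapping.keys (a *\<^sub>R x + b *\<^sub>R y) \<subseteq> {..<d}"
  proof
    fix i assume i: "i \<in> Poly_Mapping.keys (a *\<^sub>R x + b *\<^sub>R y)"
    then have "i \<in> Poly_Mapping.keys x \<or> i \<in> Poly_Mapping.keys y"
      unfolding in_keys_iff lookup_add lookup_scaleR by auto
    then show "i \<in> {..<d}" using xy by (auto simp: hypercube_def euclidean_subspace_def)
  qed
  have "a * Poly_Mapping.lookup x i + b * Poly_Mapping.lookup y i \<le> real k" if "i < d" for i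
    using that xy ab by (intro convex_bound_le) (auto simp: hypercube_def)
  then show "a *\<^sub>R x + b *\<^sub>R y \<in> hypercube d k"
    using keys xy ab by (auto simp: hypercube_def euclidean_subspace_def lookup_add)
qed

text \<open>Coordinates beyond the first \<open>2 * m + 1\<close> stay 0, so even \<open>d\<close>
  is covered as well; \<open>k \<ge> 1\<close> puts the 0/1 points into the cube.\<close>

lemma lattice_polytope_small_facial_distance:
  assumes k: "k \<ge> 1" and d: "2 * m + 1 \<le> d"
  obtains P where "lattice_polytope d k P" "card (vertices P) \<ge> 2" "facial_distance P \<le> 1 / 2 ^ m"
proof -
  obtain A B u c p q where fin: "finite A" "finite B"
    and AB: "A \<union> B \<subseteq> {x \<in> euclidean_subspace (2 * m + 1). \<forall>i. Poly_Mapping.lookup x i \<in> {0, 1}}"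
    and A: "\<And>x. x \<in> A \<Longrightarrow> u \<bullet> x = c + 1" and B: "\<And>x. x \<in> B \<Longrightarrow> u \<bullet> x = c"
    and p: "p \<in> convex hull A" and q: "q \<in> convex hull B" and pq: "dist p q = 1 / 2 ^ m"
    using close_zero_one_hulls[of m] by blast
  define P where "P = convex hull (A \<union> B)"
  have "euclidean_subspace (2 * m + 1) \<subseteq> euclidean_subspace d"
    using d by (force simp: euclidean_subspace_def)
  with AB have AB': "A \<union> B \<subseteq> {x \<in> euclidean_subspace d. \<forall>i. Poly_Mapping.lookup x i \<in> {0, 1}}"
    by blast
  have int: "A \<union> B \<subseteq> integer_lattice d"
  proof
    fix x assume "x \<in> A \<union> B"
    then have x: "x \<in> euclidean_subspace d" "\<And>i. Poly_Mapping.lookup x i \<in> {0, 1}" using AB' by auto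
    have "{0, 1} \<subseteq> (\<int> :: real set)" by auto
    then have "Poly_Mapping.lookup x i \<in> \<int>" for i using x(2) by blast
    then show "x \<in> integer_lattice d" using x(1) by (simp add: integer_lattice_def)
  qed
  have cube: "A \<union> B \<subseteq> hypercube d k"
  proof
    fix x assume "x \<in> A \<union> B"
    then have x: "x \<in> euclidean_subspace d" "\<And>i. Poly_Mapping.lookup x i \<in> {0, 1}" using AB' by auto
    have "{0, 1} \<subseteq> {0..real k}" using k by auto
    then have "Poly_Mapping.lookup x i \<in> {0..real k}" for i using x(2) by blast
    then show "x \<in> hypercube d k" using x(1) by (simp add: hypercube_def)
  qed
  have "lattice_polytope d k P"
    unfolding lattice_polytope_def
  proof (intro conjI)
    show "polytope P" using fin by (auto simp: P_def polytope_def)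
    show "P \<noteq> {}" using p by (auto simp: P_def)
    show "vertices P \<subseteq> integer_lattice d"
      using extreme_points_of_convex_hull[of "A \<union> B"] int by (auto simp: vertices_def P_def)
    show "P \<subseteq> hypercube d k"
      unfolding P_def using cube convex_hypercube by (rule hull_minimal)
  qed
  with facial_distance_parallel_le[OF fin A B p q] pq that show ?thesis
    by (simp add: P_def)
qed

section \<open>Comparison of growth rates and conclusion\<close>

text \<open>The logarithm of the left side has order \<open>sqrt d * ln d\<close>, that of the right
  side is linear in \<open>d\<close>.\<close>

lemma eventually_powr_sqrt_le_power2:
  assumes "k \<ge> 1"
  shows "\<forall>\<^sub>F d in sequentially. (real k * sqrt (real d)) powr sqrt (real d) \<le> 2 ^ ((d - 1) div 2)"
proof -
  have "real k > 0" using assms by simp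
  then have "\<forall>\<^sub>F d::nat in sequentially.
      (real k * sqrt (real d)) powr sqrt (real d) \<le> 2 powr (real d / 2 - 1)"
    by real_asymp
  then show ?thesis
  proof eventually_elim
    case (elim d)
    \<comment> \<open>The rounding in \<open>div\<close> costs at most this much, which allows a
      comparison of smooth functions above.\<close>
    have "real d / 2 - 1 \<le> real ((d - 1) div 2)" by linarith
    then have "2 powr (real d / 2 - 1) \<le> 2 powr real ((d - 1) div 2)" by simp
    also have "\<dots> = 2 ^ ((d - 1) div 2)" by (simp add: powr_realpow)
    finally show ?case using elim by linarith
  qed
qed

theorem theorem1p3:
  fixes k :: nat
  assumes "k \<ge> 1"
  shows "\<exists>d\<^sub>0::nat. \<forall>d\<ge>d\<^sub>0.
    (let \<Phi>s = facial_distance ` {P. lattice_polytope d k P \<and> card (vertices P) \<ge> 2}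
     in finite \<Phi>s \<and> \<Phi>s \<noteq> {} \<and>
        1 / (real k * real d) ^ (2 * d) \<le> Min \<Phi>s \<and>
        Min \<Phi>s \<le> 1 / (real k * sqrt (real d)) powr (sqrt (real d)))"
proof -
  obtain N where N: "\<And>d. d \<ge> N \<Longrightarrow>
      (real k * sqrt (real d)) powr sqrt (real d) \<le> 2 ^ ((d - 1) div 2)"
    using eventually_powr_sqrt_le_power2[OF assms] unfolding eventually_sequentially by blast
  show ?thesis
  proof (intro exI allI impI)
    \<comment> \<open>Only the upper bound needs \<open>N\<close>. The 1 excludes
      \<open>d = 0\<close>, where truncated subtraction would break
      \<open>2 * ((d - 1) div 2) + 1 \<le> d\<close>.\<close>
    fix d assume d: "d \<ge> max N 1"
    define S where "S = facial_distance ` {P. lattice_polytope d k P \<and> card (vertices P) \<ge> 2}"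
    have fin: "finite S"
      unfolding S_def by (intro finite_imageI finite_subset[OF _ finite_lattice_polytopes]) auto
    have dm: "2 * ((d - 1) div 2) + 1 \<le> d" using d by linarith
    obtain P where P: "lattice_polytope d k P" "card (vertices P) \<ge> 2"
      "facial_distance P \<le> 1 / 2 ^ ((d - 1) div 2)"
      by (rule lattice_polytope_small_facial_distance[OF assms dm])
    have PS: "facial_distance P \<in> S" using P by (auto simp: S_def)
    have "1 / (real k * real d) ^ (2 * d) \<le> Min S"
      using fin PS facial_distance_lattice_polytope_ge[OF _ _ assms]
      by (subst Min_ge_iff) (auto simp: S_def)
    moreover have "Min S \<le> 1 / (real k * sqrt (real d)) powr (sqrt (real d))"
    proof -
      have "Min S \<le> facial_distance P" using fin PS by (rule Min_le)
      also note P(3)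
      also have "1 / 2 ^ ((d - 1) div 2) \<le> 1 / (real k * sqrt (real d)) powr (sqrt (real d))"
        using N[of d] d assms by (intro divide_left_mono) auto
      finally show ?thesis .
    qed
    ultimately show "let \<Phi>s = facial_distance ` {P. lattice_polytope d k P \<and> card (vertices P) \<ge> 2}
     in finite \<Phi>s \<and> \<Phi>s \<noteq> {} \<and>
        1 / (real k * real d) ^ (2 * d) \<le> Min \<Phi>s \<and>
        Min \<Phi>s \<le> 1 / (real k * sqrt (real d)) powr (sqrt (real d))"
      unfolding Let_def S_def[symmetric] using fin PS by blast
  qed
qed

end
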